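(* For $k\in\{0,\dots,N\}$, the generating function $\varphi_k(z):=\mathbb E\big(z^{Y_m}\,\big|\,Y_{m-1}=k\big)$ satisfies $$\varphi_k(z)=\mathbb E\Big(\big((1-P_m)z+P_m\big)^{N-k}\big(R_mz+1-R_m\big)^k\Big).$$ Consequently, if $Y$ has the stationary distribution of $(Y_m)_m$ and $\varphi(z):=\mathbb E\,z^Y$ is its $z$-transform, then $\varphi$ satisfies the fixed-point equation $$\varphi(z)=\mathbb E\left(\big((1-P)z+P\big)^N\,\varphi\left(\frac{Rz+1-R}{(1-P)z+P}\right)\right).$$
   Context: Erdős–Rényi graph with resampling: $(P_m,R_m)_{m\in\mathbb N}$ is a sequence of i.i.d. random vectors in $(0,1)^2$, and $(P,R)$ denotes a generic sample of $(P_m,R_m)$ (for a given $m$, $P_m$ and $R_m$ are not necessarily independent of each other). There are $N$ edges, each in state $0$ (absent) or $1$ (present). In slot $m$, given $(P_m,R_m)$ and the states at time $m-1$, all edges move independently of one another according to the same transition matrix on $\{0,1\}$ $$\begin{pmatrix}P_m&1-P_m\\1-R_m&R_m\end{pmatrix},$$ i.e. an absent edge stays absent with probability $P_m$ and a present edge stays present with probability $R_m$; the same sample $(P_m,R_m)$ applies to all edges, and it is independent of the past. $Y_m$ is the number of present edges at time $m$, a Markov chain on $\{0,\dots,N\}$. *)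

theory Defs
  imports "HOL-Probability.Probability"
begin

text \<open>The transition matrix of one edge; \<open>True\<close> is state 1 (present), \<open>False\<close> is state 0 (absent).\<close>

definition edge_trans :: "real \<Rightarrow> real \<Rightarrow> bool \<Rightarrow> bool \<Rightarrow> real" where
  "edge_trans p r a b =
     (if a then (if b then r else 1 - r) else (if b then 1 - p else p))"

text \<open>
  \<open>X m i\<close> is the state of edge \<open>i < N\<close> at time \<open>m \<ge> 0\<close>; slot \<open>m \<ge> 1\<close> leads from time \<open>m - 1\<close> to
  time \<open>m\<close> and uses the sample \<open>(P m, R m)\<close>, so \<open>(P 0, R 0)\<close> plays no role.
  \<open>info M N P R X k e\<close> is the sigma-algebra generated by the edge states at times \<open>0..k\<close> and the
  samples of the slots \<open>1..e\<close>.
\<close>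

definition info ::
  "'a measure \<Rightarrow> nat \<Rightarrow> (nat \<Rightarrow> 'a \<Rightarrow> real) \<Rightarrow> (nat \<Rightarrow> 'a \<Rightarrow> real) \<Rightarrow> (nat \<Rightarrow> nat \<Rightarrow> 'a \<Rightarrow> bool)
    \<Rightarrow> nat \<Rightarrow> nat \<Rightarrow> 'a measure" where
  "info M N P R X k e = sigma (space M)
     ({X j i -` B \<inter> space M | j i B. j \<le> k \<and> i < N} \<union>
      {(\<lambda>\<omega>. (P j \<omega>, R j \<omega>)) -` A \<inter> space M | j A. 1 \<le> j \<and> j \<le> e \<and> A \<in> sets borel})"

locale er_resampling = prob_space M
  for M :: "'a measure" and N :: nat
    and P R :: "nat \<Rightarrow> 'a \<Rightarrow> real" and X :: "nat \<Rightarrow> nat \<Rightarrow> 'a \<Rightarrow> bool" +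
  assumes states_measurable:
      "\<And>m i. i < N \<Longrightarrow> X m i \<in> measurable M (count_space UNIV)"
    and samples_range:
      "\<And>m \<omega>. 1 \<le> m \<Longrightarrow> \<omega> \<in> space M \<Longrightarrow> P m \<omega> \<in> {0<..<1} \<and> R m \<omega> \<in> {0<..<1}"
    and samples_indep:
      "indep_vars (\<lambda>_. borel) (\<lambda>m \<omega>. (P m \<omega>, R m \<omega>)) {1..}"
    and samples_ident:
      "\<And>m. 1 \<le> m \<Longrightarrow>
         distr M borel (\<lambda>\<omega>. (P m \<omega>, R m \<omega>)) = distr M borel (\<lambda>\<omega>. (P 1 \<omega>, R 1 \<omega>))"
    and sample_indep_past:
      "\<And>m. 1 \<le> m \<Longrightarrow>
         indep_set (sets (vimage_algebra (space M) (\<lambda>\<omega>. (P m \<omega>, R m \<omega>)) borel))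
                   (sets (info M N P R X (m - 1) (m - 1)))"
    and edges_move:
      "\<And>m x. 1 \<le> m \<Longrightarrow>
         AE \<omega> in M.
           real_cond_exp M (info M N P R X (m - 1) m)
             (indicator {\<omega> \<in> space M. \<forall>i<N. X m i \<omega> = x i}) \<omega>
           = (\<Prod>i<N. edge_trans (P m \<omega>) (R m \<omega>) (X (m - 1) i \<omega>) (x i))"

definition num_present :: "nat \<Rightarrow> (nat \<Rightarrow> nat \<Rightarrow> 'a \<Rightarrow> bool) \<Rightarrow> nat \<Rightarrow> 'a \<Rightarrow> nat" where
  "num_present N X m \<omega> = card {i. i < N \<and> X m i \<omega>}"

text \<open>
  \<open>E(z ^ Y m | Y (m - 1) = k)\<close>: the expectation under the conditional measure
  given the event \<open>Y (m - 1) = k\<close>, meaningful only if this event has positive probability.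
\<close>

definition cond_gen_fun :: "'a measure \<Rightarrow> (nat \<Rightarrow> 'a \<Rightarrow> nat) \<Rightarrow> nat \<Rightarrow> nat \<Rightarrow> complex \<Rightarrow> complex" where
  "cond_gen_fun M Y m k z =
     (\<integral>\<omega>. z ^ Y m \<omega> \<partial>uniform_measure M {\<omega> \<in> space M. Y (m - 1) \<omega> = k})"

definition z_transform :: "'a measure \<Rightarrow> ('a \<Rightarrow> nat) \<Rightarrow> complex \<Rightarrow> complex" where
  "z_transform M Y z = (\<integral>\<omega>. z ^ Y \<omega> \<partial>M)"

definition transition_matrix ::
  "'a measure \<Rightarrow> nat set \<Rightarrow> (nat \<Rightarrow> 'a \<Rightarrow> nat) \<Rightarrow> (nat \<Rightarrow> nat \<Rightarrow> real) \<Rightarrow> bool" where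
  "transition_matrix M S Y Q \<longleftrightarrow>
     (\<forall>k\<in>S. (\<forall>l\<in>S. 0 \<le> Q k l) \<and> (\<Sum>l\<in>S. Q k l) = 1) \<and>
     (\<forall>m\<ge>1. \<forall>k\<in>S. \<forall>l\<in>S. \<P>(\<omega> in M. Y (m - 1) \<omega> = k) > 0 \<longrightarrow>
        \<P>(\<omega> in M. Y m \<omega> = l \<bar> Y (m - 1) \<omega> = k) = Q k l)"

text \<open>
  For the chain \<open>num_present\<close> the transition matrix is unique on \<open>{..N}\<close>: since all samples lie in
  the open unit square, every state has positive probability at every time \<open>m \<ge> 1\<close>.
\<close>

definition stationary_distribution ::
  "'a measure \<Rightarrow> nat set \<Rightarrow> (nat \<Rightarrow> 'a \<Rightarrow> nat) \<Rightarrow> nat pmf \<Rightarrow> bool" where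
  "stationary_distribution M S Y \<pi> \<longleftrightarrow>
     set_pmf \<pi> \<subseteq> S \<and>
     (\<exists>Q. transition_matrix M S Y Q \<and> (\<forall>l\<in>S. pmf \<pi> l = (\<Sum>k\<in>S. pmf \<pi> k * Q k l)))"

end

theory Submission
  imports Defs
begin

text \<open>
  Given the sample \<open>(p, r)\<close> of a slot, the edges move independently: each of the \<open>N - k\<close> absent edges
  contributes a present edge with generating function \<open>(1 - p) z + p\<close>, and each of the \<open>k\<close> present
  edges one with generating function \<open>r z + 1 - r\<close>. The conditional generating function of the new
  number of present edges is therefore a product that depends on the old configuration only through
  its size; algebraically this is the expansion of a product of binomials over the subsets of the
  edge set (\<open>sum_edge_trans_eq_slot_gf\<close>). Since the sample is independent of the past, averaging
  over the event that the old size is \<open>k\<close> factors into the probability of the event and the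
  expectation of that product (\<open>integral_indicator_gen_fun\<close>), and dividing by the probability
  gives the first claim. The conditioning event is never null after the first slot, because all
  samples lie in the open unit square, so every configuration has a positive transition probability
  (\<open>prob_num_present_pos\<close>).

  The fixed-point equation follows from invariance: \<open>\<phi>(z) = \<Sum>k. \<pi>(k) \<phi>\<^sub>k(z)\<close>, where \<open>\<phi>\<^sub>k(z)\<close>, being
  the same for all slots, is the generating function of row \<open>k\<close> of the transition matrix
  (\<open>sum_transition_matrix\<close>). Pulling \<open>((1 - p) z + p) ^ N\<close> out of the products turns the sum over
  \<open>k\<close> under the expectation into \<open>\<phi>\<close> evaluated at the ratio of the two one-edge generating
  functions.
\<close>

section \<open>The generating function of one slot with a given sample\<close>

definition slot_gf :: "nat \<Rightarrow> nat \<Rightarrow> complex \<Rightarrow> real \<times> real \<Rightarrow> complex" where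
  "slot_gf N k z = (\<lambda>(p, r).
     ((1 - complex_of_real p) * z + complex_of_real p) ^ (N - k)
       * (complex_of_real r * z + 1 - complex_of_real r) ^ k)"

lemma slot_gf_measurable [measurable]: "slot_gf N k z \<in> borel_measurable borel"
  unfolding slot_gf_def case_prod_beta
  by (intro borel_measurable_continuous_onI continuous_intros)

text \<open>
  Each factor is a convex combination of \<open>z\<close> and \<open>1\<close>. The bound is uniform in the sample and yields
  integrability for arbitrary complex \<open>z\<close>, also outside the unit disc.
\<close>

lemma norm_slot_gf_le:
  assumes "k \<le> N" "p \<in> {0<..<1}" "r \<in> {0<..<1}"
  shows "norm (slot_gf N k z (p, r)) \<le> (norm z + 1) ^ N"
proof -
  have conv: "norm (complex_of_real a * z + complex_of_real b) \<le> norm z + 1"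
    if "0 \<le> a" "a \<le> 1" "0 \<le> b" "b \<le> 1" for a b
  proof -
    have "norm (complex_of_real a * z + complex_of_real b) \<le> a * norm z + b"
      using norm_triangle_ineq[of "complex_of_real a * z" "complex_of_real b"] that
      by (simp add: norm_mult)
    also have "\<dots> \<le> norm z + 1"
      using that mult_right_mono[of a 1 "norm z"] by simp
    finally show ?thesis .
  qed
  have "norm ((1 - complex_of_real p) * z + complex_of_real p) \<le> norm z + 1"
    using conv[of "1 - p" p] assms by simp
  moreover have "norm (complex_of_real r * z + 1 - complex_of_real r) \<le> norm z + 1"
    using conv[of r "1 - r"] assms by (simp add: algebra_simps)
  ultimately have "norm (slot_gf N k z (p, r)) \<le> (norm z + 1) ^ (N - k) * (norm z + 1) ^ k"
    unfolding slot_gf_def by (auto simp: norm_mult norm_power intro!: mult_mono power_mono)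
  also have "\<dots> = (norm z + 1) ^ N"
    using assms(1) by (simp flip: power_add)
  finally show ?thesis .
qed

text \<open>
  Here \<open>T\<close> is the old and \<open>S\<close> the new set of present edges. Distributing \<open>z ^ card S\<close> over the edges
  of \<open>S\<close> exhibits the sum over \<open>S\<close> as the expanded product, over all edges, of a weight for
  becoming present plus a weight for becoming absent; this weight depends only on membership in \<open>T\<close>.
\<close>

lemma sum_edge_trans_eq_slot_gf:
  assumes "T \<subseteq> {..<N}"
  shows "(\<Sum>S\<in>Pow {..<N}. z ^ card S *
            complex_of_real (\<Prod>i<N. edge_trans p r (i \<in> T) (i \<in> S)))
         = slot_gf N (card T) z (p, r)"
proof -
  have fin: "finite T" using assms finite_subset by blast
  define f where "f b i = complex_of_real (edge_trans p r (i \<in> T) b)" for b i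
  have split_prod: "z ^ card S * complex_of_real (\<Prod>i<N. edge_trans p r (i \<in> T) (i \<in> S))
        = (\<Prod>i\<in>S. z * f True i) * (\<Prod>i\<in>{..<N} - S. f False i)"
    if "S \<in> Pow {..<N}" for S
  proof -
    have "(\<Prod>i<N. f (i \<in> S) i) = (\<Prod>i\<in>{..<N} - S. f (i \<in> S) i) * (\<Prod>i\<in>S. f (i \<in> S) i)"
      using that by (intro prod.subset_diff) auto
    also have "\<dots> = (\<Prod>i\<in>{..<N} - S. f False i) * (\<Prod>i\<in>S. f True i)"
      by simp
    finally show ?thesis
      by (simp add: f_def prod.distrib)
  qed
  have "(\<Sum>S\<in>Pow {..<N}. z ^ card S *
            complex_of_real (\<Prod>i<N. edge_trans p r (i \<in> T) (i \<in> S)))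
        = (\<Prod>i<N. z * f True i + f False i)"
    unfolding prod_add[OF finite_lessThan] by (intro sum.cong refl split_prod)
  also have "\<dots> = (\<Prod>i\<in>{..<N} - T. z * f True i + f False i) * (\<Prod>i\<in>T. z * f True i + f False i)"
    using assms by (intro prod.subset_diff) auto
  also have "\<dots> = slot_gf N (card T) z (p, r)"
    using assms fin by (simp add: f_def edge_trans_def slot_gf_def card_Diff_subset algebra_simps)
  finally show ?thesis .
qed

section \<open>Configurations and the information available before a slot\<close>

text \<open>
  Configurations are encoded as subsets of \<open>{..<N}\<close>: unlike \<open>\<lambda>i. X m i \<omega>\<close>, which is arbitrary
  beyond \<open>N\<close>, they range over a finite set that can be summed over.
\<close>

definition present :: "nat \<Rightarrow> (nat \<Rightarrow> nat \<Rightarrow> 'a \<Rightarrow> bool) \<Rightarrow> nat \<Rightarrow> 'a \<Rightarrow> nat set" where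
  "present N X m \<omega> = {i. i < N \<and> X m i \<omega>}"

lemma present_subset: "present N X m \<omega> \<subseteq> {..<N}"
  by (auto simp: present_def)

lemma num_present_eq: "num_present N X m \<omega> = card (present N X m \<omega>)"
  by (simp add: num_present_def present_def)

lemma num_present_le: "num_present N X m \<omega> \<le> N"
  using card_mono[OF _ present_subset[of N X m \<omega>]] by (simp add: num_present_eq)

lemma present_eq_iff:
  assumes "S \<subseteq> {..<N}"
  shows "present N X m \<omega> = S \<longleftrightarrow> (\<forall>i<N. X m i \<omega> = (i \<in> S))"
  using assms by (auto simp: present_def)

context er_resampling
begin

lemma sample_measurable [measurable]:
  "1 \<le> m \<Longrightarrow> (\<lambda>\<omega>. (P m \<omega>, R m \<omega>)) \<in> borel_measurable M"
  using samples_indep by (auto simp: indep_vars_def)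

lemma space_info [simp]: "space (info M N P R X k e) = space M"
  by (simp add: info_def space_measure_of_conv)

lemma sets_info:
  "sets (info M N P R X k e) = sigma_sets (space M)
     ({X j i -` B \<inter> space M | j i B. j \<le> k \<and> i < N} \<union>
      {(\<lambda>\<omega>. (P j \<omega>, R j \<omega>)) -` A \<inter> space M | j A. 1 \<le> j \<and> j \<le> e \<and> A \<in> sets borel})"
  unfolding info_def by (rule sets_measure_of) auto

lemma info_mono_samples:
  assumes "e \<le> e'"
  shows "sets (info M N P R X k e) \<subseteq> sets (info M N P R X k e')"
  unfolding sets_info using assms by (intro sigma_sets_mono') (blast intro: le_trans)

lemma subalgebra_info: "subalgebra M (info M N P R X k e)"
  unfolding subalgebra_def sets_info
  using states_measurable sample_measurable
  by (auto intro!: sets.sigma_sets_subset simp: measurable_sets)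

lemma state_info_measurable:
  assumes "i < N" "j \<le> k"
  shows "{\<omega> \<in> space M. X j i \<omega> = b} \<in> sets (info M N P R X k e)"
proof -
  have "{\<omega> \<in> space M. X j i \<omega> = b} = X j i -` {b} \<inter> space M"
    by auto
  then show ?thesis
    unfolding sets_info using assms by (intro sigma_sets.Basic) blast
qed

lemma present_event_info:
  assumes "S \<subseteq> {..<N}" "j \<le> k"
  shows "{\<omega> \<in> space M. present N X j \<omega> = S} \<in> sets (info M N P R X k e)"
proof -
  have "{\<omega> \<in> space (info M N P R X k e). \<forall>i\<in>{..<N}. X j i \<omega> = (i \<in> S)}
          \<in> sets (info M N P R X k e)"
    using assms(2) by (intro sets.sets_Collect_finite_All) (auto intro: state_info_measurable)
  also have "{\<omega> \<in> space (info M N P R X k e). \<forall>i\<in>{..<N}. X j i \<omega> = (i \<in> S)}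
      = {\<omega> \<in> space M. present N X j \<omega> = S}"
    using present_eq_iff[OF assms(1), of X j] by auto
  finally show ?thesis .
qed

lemma num_present_event_info:
  assumes "j \<le> k"
  shows "{\<omega> \<in> space M. num_present N X j \<omega> = l} \<in> sets (info M N P R X k e)"
proof -
  have "{\<omega> \<in> space M. num_present N X j \<omega> = l}
      = (\<Union>S\<in>{S \<in> Pow {..<N}. card S = l}. {\<omega> \<in> space M. present N X j \<omega> = S})"
    by (auto simp: num_present_eq dest: subsetD[OF present_subset])
  also have "\<dots> \<in> sets (info M N P R X k e)"
    using assms by (intro sets.finite_UN) (auto intro: present_event_info)
  finally show ?thesis .
qed

lemma present_event [simp]:
  "S \<subseteq> {..<N} \<Longrightarrow> {\<omega> \<in> space M. present N X m \<omega> = S} \<in> sets M"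
  using present_event_info[of S m m 0] subalgebra_info by (auto simp: subalgebra_def)

lemma num_present_event [simp]: "{\<omega> \<in> space M. num_present N X m \<omega> = l} \<in> sets M"
  using num_present_event_info[of m m l 0] subalgebra_info by (auto simp: subalgebra_def)

section \<open>One step of the chain\<close>

text \<open>
  The defining property of conditional expectation, integrated over an event \<open>A\<close> that is known once
  the configuration at time \<open>m - 1\<close> and the sample of slot \<open>m\<close> have been revealed.
\<close>

lemma prob_next_present:
  assumes m: "1 \<le> m" and S: "S \<subseteq> {..<N}" and A: "A \<in> sets (info M N P R X (m - 1) m)"
  defines "K \<equiv> \<lambda>\<omega>. \<Prod>i<N. edge_trans (P m \<omega>) (R m \<omega>) (X (m - 1) i \<omega>) (i \<in> S)"
  shows "integrable M (\<lambda>\<omega>. indicator A \<omega> * K \<omega>)"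
    and "prob (A \<inter> {\<omega> \<in> space M. present N X m \<omega> = S}) = (\<integral>\<omega>. indicator A \<omega> * K \<omega> \<partial>M)"
proof -
  define F where "F = info M N P R X (m - 1) m"
  interpret F: finite_measure_subalgebra M F
    by unfold_locales (simp add: F_def subalgebra_info)
  define B where "B = {\<omega> \<in> space M. present N X m \<omega> = S}"
  have [measurable]: "A \<in> sets M" "B \<in> sets M"
    using A F.subalg S by (auto simp: subalgebra_def F_def B_def)
  have "B = {\<omega> \<in> space M. \<forall>i<N. X m i \<omega> = (i \<in> S)}"
    by (simp add: B_def present_eq_iff[OF S])
  then have ce: "AE \<omega> in M. real_cond_exp M F (indicator B) \<omega> = K \<omega>"
    using edges_move[OF m, of "\<lambda>i. i \<in> S"] by (simp add: F_def K_def)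
  have ae: "AE \<omega> in M. indicator A \<omega> * real_cond_exp M F (indicator B) \<omega> = indicator A \<omega> * K \<omega>"
    using ce by eventually_elim simp
  have [measurable]: "(\<lambda>\<omega>. X (m - 1) i \<omega>) \<in> measurable M (count_space UNIV)" if "i < N" for i
    using states_measurable that by simp
  have [measurable]: "P m \<in> borel_measurable M" "R m \<in> borel_measurable M"
    using borel_measurable_continuous_on[OF continuous_on_fst[OF continuous_on_id] sample_measurable[OF m]]
      borel_measurable_continuous_on[OF continuous_on_snd[OF continuous_on_id] sample_measurable[OF m]]
    by simp_all
  have [measurable]: "K \<in> borel_measurable M"
    unfolding K_def edge_trans_def by measurable
  have AB: "integrable M (\<lambda>\<omega>. indicator A \<omega> * indicator B \<omega> :: real)"
    by (simp add: less_top[symmetric] flip: indicator_inter_arith)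
  have "integrable M (\<lambda>\<omega>. indicator A \<omega> * real_cond_exp M F (indicator B) \<omega>)"
    using A AB by (intro F.real_cond_exp_intg(1)) (auto simp: F_def)
  then show "integrable M (\<lambda>\<omega>. indicator A \<omega> * K \<omega>)"
    by (rule integrable_cong_AE_imp) (use ae in auto)
  have "prob (A \<inter> B) = (\<integral>\<omega>. indicator A \<omega> * indicator B \<omega> \<partial>M)"
    by (simp flip: indicator_inter_arith)
  also have "\<dots> = (\<integral>\<omega>. indicator A \<omega> * real_cond_exp M F (indicator B) \<omega> \<partial>M)"
    using A AB by (intro F.real_cond_exp_intg(2)[symmetric]) (auto simp: F_def)
  also have "\<dots> = (\<integral>\<omega>. indicator A \<omega> * K \<omega> \<partial>M)"
    by (rule integral_cong_AE) (use ae in auto)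
  finally show "prob (A \<inter> {\<omega> \<in> space M. present N X m \<omega> = S}) = (\<integral>\<omega>. indicator A \<omega> * K \<omega> \<partial>M)"
    by (simp add: B_def)
qed

lemma edge_trans_pos:
  assumes "1 \<le> m" "\<omega> \<in> space M"
  shows "0 < edge_trans (P m \<omega>) (R m \<omega>) a b"
  using samples_range[OF assms] by (auto simp: edge_trans_def)

text \<open>
  It suffices to reach one particular configuration with \<open>k\<close> present edges, for which \<open>{..<k}\<close> is
  taken: its conditional probability is a product of strictly positive factors, whatever the
  previous configuration.
\<close>

lemma prob_num_present_pos:
  assumes m: "1 \<le> m" and k: "k \<le> N"
  shows "0 < prob {\<omega> \<in> space M. num_present N X m \<omega> = k}"
proof -
  define K where
    "K \<omega> = (\<Prod>i<N. edge_trans (P m \<omega>) (R m \<omega>) (X (m - 1) i \<omega>) (i \<in> {..<k}))" for \<omega>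
  have S: "{..<k} \<subseteq> {..<N}" using k by auto
  have A: "space M \<in> sets (info M N P R X (m - 1) m)"
    using sets.top[of "info M N P R X (m - 1) m"] by simp
  have int: "integrable M (\<lambda>\<omega>. indicator (space M) \<omega> * K \<omega>)"
    using prob_next_present(1)[OF m S A] by (simp add: K_def)
  have "(\<integral>\<omega>. 0 \<partial>M) < (\<integral>\<omega>. indicator (space M) \<omega> * K \<omega> \<partial>M)"
    using int by (intro integral_less_AE_space AE_I2)
      (auto simp: K_def emeasure_space_1 intro!: prod_pos edge_trans_pos m)
  also have "\<dots> = prob {\<omega> \<in> space M. present N X m \<omega> = {..<k}}"
    using prob_next_present(2)[OF m S A]
    by (simp add: K_def Int_absorb1 subset_eq)
  also have "\<dots> \<le> prob {\<omega> \<in> space M. num_present N X m \<omega> = k}"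
  proof (rule finite_measure_mono[OF _ num_present_event], rule subsetI)
    fix \<omega> assume "\<omega> \<in> {\<omega> \<in> space M. present N X m \<omega> = {..<k}}"
    then have "\<omega> \<in> space M" and "present N X m \<omega> = {..<k}"
      by blast+
    then show "\<omega> \<in> {\<omega> \<in> space M. num_present N X m \<omega> = k}"
      by (simp only: num_present_eq card_lessThan mem_Collect_eq)
  qed
  finally show ?thesis by simp
qed

lemma integrable_slot_gf:
  assumes "1 \<le> m" "k \<le> N"
  shows "integrable M (\<lambda>\<omega>. slot_gf N k z (P m \<omega>, R m \<omega>))"
proof (rule integrable_const_bound)
  show "AE \<omega> in M. norm (slot_gf N k z (P m \<omega>, R m \<omega>)) \<le> (norm z + 1) ^ N"
    using samples_range[OF assms(1)] assms(2) by (intro AE_I2 norm_slot_gf_le) auto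
  show "(\<lambda>\<omega>. slot_gf N k z (P m \<omega>, R m \<omega>)) \<in> borel_measurable M"
    using measurable_compose[OF sample_measurable[OF assms(1)] slot_gf_measurable] .
qed

text \<open>
  The independence of sigma-algebras is turned into independence of two complex random variables,
  the form to which the product rule for expectations applies. Composing the sample with \<open>f\<close> at this
  stage gives both variables the same value type, as \<^const>\<open>prob_space.indep_var\<close> demands.
\<close>

lemma indep_sample_past_event:
  fixes f :: "real \<times> real \<Rightarrow> complex"
  assumes m: "1 \<le> m" and A: "A \<in> sets (info M N P R X (m - 1) (m - 1))"
    and f: "f \<in> borel_measurable borel"
  shows "indep_var borel (\<lambda>\<omega>. f (P m \<omega>, R m \<omega>)) borel (indicator A :: 'a \<Rightarrow> complex)"
  unfolding indep_var_eq
proof (intro conjI)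
  define F where "F = info M N P R X (m - 1) (m - 1)"
  have [measurable]: "A \<in> sets F" and sp: "space F = space M" and sub: "sets F \<subseteq> sets M"
    using A subalgebra_info by (auto simp: F_def subalgebra_def)
  show "(\<lambda>\<omega>. f (P m \<omega>, R m \<omega>)) \<in> borel_measurable M"
    by (rule measurable_compose[OF sample_measurable[OF m] f])
  show "(indicator A :: 'a \<Rightarrow> complex) \<in> borel_measurable M"
    using sub \<open>A \<in> sets F\<close> by (intro borel_measurable_indicator) auto
  have meas: "(indicator A :: 'a \<Rightarrow> complex) \<in> borel_measurable F"
    by measurable
  have "{(indicator A :: 'a \<Rightarrow> complex) -` B \<inter> space M | B. B \<in> sets borel} \<subseteq> sets F"
    using measurable_sets[OF meas] sp by auto
  then have past: "sigma_sets (space M) {(indicator A :: 'a \<Rightarrow> complex) -` B \<inter> space M | B. B \<in> sets borel}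
      \<subseteq> sets F"
    using sets.sigma_sets_subset[of _ F] sp by simp
  define V where "V = vimage_algebra (space M) (\<lambda>\<omega>. (P m \<omega>, R m \<omega>)) borel"
  have spV: "space V = space M" by (simp add: V_def)
  have "(\<lambda>\<omega>. f (P m \<omega>, R m \<omega>)) \<in> borel_measurable V"
    by (rule measurable_compose[OF _ f]) (simp add: V_def measurable_vimage_algebra1)
  then have "{(\<lambda>\<omega>. f (P m \<omega>, R m \<omega>)) -` B \<inter> space M | B. B \<in> sets borel} \<subseteq> sets V"
    using measurable_sets[of _ V borel] spV by auto
  then have "sigma_sets (space M) {(\<lambda>\<omega>. f (P m \<omega>, R m \<omega>)) -` B \<inter> space M | B. B \<in> sets borel}
      \<subseteq> sets V"
    using sets.sigma_sets_subset[of _ V] spV by simp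
  then show "indep_set
      (sigma_sets (space M) {(\<lambda>\<omega>. f (P m \<omega>, R m \<omega>)) -` A \<inter> space M |A. A \<in> sets borel})
      (sigma_sets (space M) {(indicator A :: 'a \<Rightarrow> complex) -` B \<inter> space M | B. B \<in> sets borel})"
    using past sample_indep_past[OF m] unfolding indep_sets2_eq F_def V_def by blast
qed

lemma integral_past_event_slot_gf:
  assumes m: "1 \<le> m" and k: "k \<le> N" and A: "A \<in> sets (info M N P R X (m - 1) (m - 1))"
  shows "(\<integral>\<omega>. indicator A \<omega> * slot_gf N k z (P m \<omega>, R m \<omega>) \<partial>M)
         = complex_of_real (prob A) * (\<integral>\<omega>. slot_gf N k z (P m \<omega>, R m \<omega>) \<partial>M)"
proof -
  have [measurable]: "A \<in> sets M"
    using A subalgebra_info by (auto simp: subalgebra_def)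
  note ind = indep_sample_past_event[OF m A slot_gf_measurable[of N k z]]
  have int: "integrable M (\<lambda>\<omega>. indicator A \<omega> :: complex)"
    by (intro integrable_const_bound[where B = 1]) (auto simp: indicator_def)
  have "(\<integral>\<omega>. (indicator A \<omega> :: complex) \<partial>M) = (\<integral>\<omega>. complex_of_real (indicator A \<omega>) \<partial>M)"
    by (intro Bochner_Integration.integral_cong) (auto simp: indicator_def)
  also have "\<dots> = complex_of_real (prob A)"
    by (simp only: integral_complex_of_real) simp
  finally have "(\<integral>\<omega>. (indicator A \<omega> :: complex) \<partial>M) = complex_of_real (prob A)" .
  then show ?thesis
    using indep_var_lebesgue_integral[OF ind integrable_slot_gf[OF m k] int]
    by (simp add: mult.commute)
qed

text \<open>
  The unnormalised form of the first claim. The event \<open>A\<close> is used with two sigma-algebras: together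
  with the sample of slot \<open>m\<close> it must be known for the transition probabilities to apply, and without
  that sample for the final factorisation by independence.
\<close>

lemma integral_indicator_gen_fun:
  assumes m: "1 \<le> m" and k: "k \<le> N"
  defines "A \<equiv> {\<omega> \<in> space M. num_present N X (m - 1) \<omega> = k}"
  shows "(\<integral>\<omega>. indicator A \<omega> * z ^ num_present N X m \<omega> \<partial>M)
         = complex_of_real (prob A) * (\<integral>\<omega>. slot_gf N k z (P m \<omega>, R m \<omega>) \<partial>M)"
proof -
  have A0: "A \<in> sets (info M N P R X (m - 1) (m - 1))"
    unfolding A_def by (rule num_present_event_info) simp
  then have A: "A \<in> sets (info M N P R X (m - 1) m)"
    using info_mono_samples[of "m - 1" m] by auto
  have [measurable]: "A \<in> sets M" by (simp add: A_def)
  define B where "B S = {\<omega> \<in> space M. present N X m \<omega> = S}" for S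
  have [measurable]: "B S \<in> sets M" if "S \<in> Pow {..<N}" for S
    using that by (simp add: B_def)
  define K where
    "K S \<omega> = (\<Prod>i<N. edge_trans (P m \<omega>) (R m \<omega>) (X (m - 1) i \<omega>) (i \<in> S))" for S \<omega>
  have ind_int: "integrable M (\<lambda>\<omega>. complex_of_real (indicator (A \<inter> B S) \<omega>))"
    if "S \<in> Pow {..<N}" for S
    using that by (intro integrable_of_real) (simp add: less_top[symmetric])
  have K_int: "integrable M (\<lambda>\<omega>. complex_of_real (indicator A \<omega> * K S \<omega>))"
    and K_eq: "prob (A \<inter> B S) = (\<integral>\<omega>. indicator A \<omega> * K S \<omega> \<partial>M)"
    if "S \<in> Pow {..<N}" for S
    using prob_next_present[OF m _ A, of S] that by (simp_all add: K_def B_def del: of_real_mult)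
  have "(\<integral>\<omega>. indicator A \<omega> * z ^ num_present N X m \<omega> \<partial>M)
      = (\<integral>\<omega>. (\<Sum>S\<in>Pow {..<N}. z ^ card S * complex_of_real (indicator (A \<inter> B S) \<omega>)) \<partial>M)"
  proof (intro Bochner_Integration.integral_cong refl)
    fix \<omega> assume \<omega>: "\<omega> \<in> space M"
    have "(\<Sum>S\<in>Pow {..<N}. z ^ card S * complex_of_real (indicator (A \<inter> B S) \<omega>))
        = (\<Sum>S\<in>{present N X m \<omega>}. z ^ card S * complex_of_real (indicator (A \<inter> B S) \<omega>))"
      using present_subset[of N X m \<omega>]
      by (intro sum.mono_neutral_right) (auto simp: B_def indicator_def)
    also have "\<dots> = indicator A \<omega> * z ^ num_present N X m \<omega>"
      using \<omega> by (simp add: num_present_eq B_def indicator_def)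
    finally show "indicator A \<omega> * z ^ num_present N X m \<omega>
        = (\<Sum>S\<in>Pow {..<N}. z ^ card S * complex_of_real (indicator (A \<inter> B S) \<omega>))" ..
  qed
  also have "\<dots> = (\<Sum>S\<in>Pow {..<N}. z ^ card S * complex_of_real (prob (A \<inter> B S)))"
    using ind_int by (simp add: Bochner_Integration.integral_sum)
  also have "\<dots> = (\<Sum>S\<in>Pow {..<N}. z ^ card S * (\<integral>\<omega>. complex_of_real (indicator A \<omega> * K S \<omega>) \<partial>M))"
    by (intro sum.cong refl) (simp only: K_eq integral_complex_of_real)
  also have "\<dots> = (\<integral>\<omega>. (\<Sum>S\<in>Pow {..<N}. z ^ card S * complex_of_real (indicator A \<omega> * K S \<omega>)) \<partial>M)"
    using K_int by (simp add: Bochner_Integration.integral_sum del: of_real_mult)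
  also have "\<dots> = (\<integral>\<omega>. indicator A \<omega> * slot_gf N k z (P m \<omega>, R m \<omega>) \<partial>M)"
  proof (intro Bochner_Integration.integral_cong refl)
    fix \<omega> assume "\<omega> \<in> space M"
    define T where "T = present N X (m - 1) \<omega>"
    have "K S \<omega> = (\<Prod>i<N. edge_trans (P m \<omega>) (R m \<omega>) (i \<in> T) (i \<in> S))" for S
      unfolding K_def T_def by (intro prod.cong refl) (auto simp: present_def)
    then have "(\<Sum>S\<in>Pow {..<N}. z ^ card S * complex_of_real (K S \<omega>))
        = slot_gf N (card T) z (P m \<omega>, R m \<omega>)"
      using sum_edge_trans_eq_slot_gf[of T N z] by (simp add: T_def present_subset)
    then show "(\<Sum>S\<in>Pow {..<N}. z ^ card S * complex_of_real (indicator A \<omega> * K S \<omega>))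
        = indicator A \<omega> * slot_gf N k z (P m \<omega>, R m \<omega>)"
      by (cases "\<omega> \<in> A") (auto simp: A_def T_def num_present_eq)
  qed
  also have "\<dots> = complex_of_real (prob A) * (\<integral>\<omega>. slot_gf N k z (P m \<omega>, R m \<omega>) \<partial>M)"
    by (rule integral_past_event_slot_gf[OF m k A0])
  finally show ?thesis .
qed

section \<open>Conditional generating functions and the transition matrix\<close>

lemma num_present_measurable: "num_present N X m \<in> measurable M (count_space UNIV)"
proof -
  have "num_present N X m -` {l} \<inter> space M = {\<omega> \<in> space M. num_present N X m \<omega> = l}" for l
    by auto
  then show ?thesis
    by (simp add: measurable_count_space_eq2_countable)
qed

lemma cond_gen_fun_eq:
  assumes m: "1 \<le> m" and k: "k \<le> N"
    and pos: "0 < prob {\<omega> \<in> space M. num_present N X (m - 1) \<omega> = k}"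
  shows "cond_gen_fun M (num_present N X) m k z = (\<integral>\<omega>. slot_gf N k z (P m \<omega>, R m \<omega>) \<partial>M)"
proof -
  define A where "A = {\<omega> \<in> space M. num_present N X (m - 1) \<omega> = k}"
  have [measurable]: "A \<in> sets M" by (simp add: A_def)
  note [measurable] = num_present_measurable
  have dens: "uniform_measure M A = density M (\<lambda>\<omega>. ennreal (indicator A \<omega> / prob A))"
    unfolding uniform_measure_def
  proof (intro density_cong AE_I2)
    fix \<omega> show "indicator A \<omega> / emeasure M A = ennreal (indicator A \<omega> / prob A)"
      using divide_ennreal[of 1 "prob A"] pos
      by (cases "\<omega> \<in> A") (simp_all add: emeasure_eq_measure A_def)
  qed auto
  have "cond_gen_fun M (num_present N X) m k z
      = (\<integral>\<omega>. (indicator A \<omega> / prob A) *\<^sub>R z ^ num_present N X m \<omega> \<partial>M)"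
    unfolding cond_gen_fun_def A_def[symmetric] dens
    by (rule integral_density) auto
  also have "\<dots> = (\<integral>\<omega>. (indicator A \<omega> * z ^ num_present N X m \<omega>) / complex_of_real (prob A) \<partial>M)"
    by (intro Bochner_Integration.integral_cong) (auto simp: indicator_def scaleR_conv_of_real)
  also have "\<dots> = (\<integral>\<omega>. indicator A \<omega> * z ^ num_present N X m \<omega> \<partial>M) / complex_of_real (prob A)"
    by simp
  also have "\<dots> = (\<integral>\<omega>. slot_gf N k z (P m \<omega>, R m \<omega>) \<partial>M)"
    using integral_indicator_gen_fun[OF m k, of z] pos by (simp add: A_def)
  finally show ?thesis .
qed

text \<open>
  The entries of \<open>Q\<close> are read off from the step from time 1 to time 2, since at time 1 every state
  has positive probability, whereas the initial distribution may miss some states. The sample of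
  slot 2 is then replaced by that of slot 1, which has the same law.
\<close>

lemma sum_transition_matrix:
  assumes Q: "transition_matrix M {..N} (num_present N X) Q" and k: "k \<le> N"
  shows "(\<Sum>l\<le>N. complex_of_real (Q k l) * z ^ l) = (\<integral>\<omega>. slot_gf N k z (P 1 \<omega>, R 1 \<omega>) \<partial>M)"
proof -
  define A where "A = {\<omega> \<in> space M. num_present N X 1 \<omega> = k}"
  define C where "C l = {\<omega> \<in> space M. num_present N X 2 \<omega> = l}" for l
  have [measurable]: "A \<in> sets M" "C l \<in> sets M" for l
    by (simp_all add: A_def C_def)
  have pos: "0 < prob A"
    unfolding A_def by (rule prob_num_present_pos) (use k in auto)
  have Q_eq: "Q k l = prob (A \<inter> C l) / prob A" if "l \<le> N" for l
  proof -
    have "\<P>(\<omega> in M. num_present N X 2 \<omega> = l \<bar> num_present N X (2 - 1) \<omega> = k) = Q k l"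
      using Q[unfolded transition_matrix_def, THEN conjunct2, rule_format, of 2 k l] k that pos
      by (simp add: A_def)
    moreover have "{\<omega> \<in> space M. num_present N X 2 \<omega> = l \<and> num_present N X 1 \<omega> = k} = A \<inter> C l"
      by (auto simp: A_def C_def)
    ultimately show ?thesis
      by (simp add: cond_prob_def A_def)
  qed
  have int: "integrable M (\<lambda>\<omega>. complex_of_real (indicator (A \<inter> C l) \<omega>))" for l
    by (intro integrable_of_real) (simp add: less_top[symmetric])
  have "(\<Sum>l\<le>N. complex_of_real (prob (A \<inter> C l)) * z ^ l)
      = (\<integral>\<omega>. (\<Sum>l\<le>N. complex_of_real (indicator (A \<inter> C l) \<omega>) * z ^ l) \<partial>M)"
    using int by (simp add: Bochner_Integration.integral_sum)
  also have "\<dots> = (\<integral>\<omega>. indicator A \<omega> * z ^ num_present N X 2 \<omega> \<partial>M)"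
  proof (intro Bochner_Integration.integral_cong refl)
    fix \<omega> assume \<omega>: "\<omega> \<in> space M"
    have "(\<Sum>l\<le>N. complex_of_real (indicator (A \<inter> C l) \<omega>) * z ^ l)
        = (\<Sum>l\<in>{num_present N X 2 \<omega>}. complex_of_real (indicator (A \<inter> C l) \<omega>) * z ^ l)"
      by (intro sum.mono_neutral_right) (auto simp: C_def indicator_def num_present_le)
    then show "(\<Sum>l\<le>N. complex_of_real (indicator (A \<inter> C l) \<omega>) * z ^ l)
        = indicator A \<omega> * z ^ num_present N X 2 \<omega>"
      using \<omega> by (simp add: C_def indicator_def)
  qed
  also have "\<dots> = complex_of_real (prob A) * (\<integral>\<omega>. slot_gf N k z (P 2 \<omega>, R 2 \<omega>) \<partial>M)"
    using integral_indicator_gen_fun[of 2 k z] k by (simp add: A_def)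
  also have "(\<integral>\<omega>. slot_gf N k z (P 2 \<omega>, R 2 \<omega>) \<partial>M)
      = integral\<^sup>L (distr M borel (\<lambda>\<omega>. (P 2 \<omega>, R 2 \<omega>))) (slot_gf N k z)"
    by (rule integral_distr[symmetric]) (auto intro: sample_measurable)
  also have "\<dots> = integral\<^sup>L (distr M borel (\<lambda>\<omega>. (P 1 \<omega>, R 1 \<omega>))) (slot_gf N k z)"
    by (subst samples_ident) auto
  also have "\<dots> = (\<integral>\<omega>. slot_gf N k z (P 1 \<omega>, R 1 \<omega>) \<partial>M)"
    by (rule integral_distr) (auto intro: sample_measurable)
  finally have *: "(\<Sum>l\<le>N. complex_of_real (prob (A \<inter> C l)) * z ^ l)
      = complex_of_real (prob A) * (\<integral>\<omega>. slot_gf N k z (P 1 \<omega>, R 1 \<omega>) \<partial>M)" .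
  have "(\<Sum>l\<le>N. complex_of_real (Q k l) * z ^ l)
      = (\<Sum>l\<le>N. complex_of_real (prob (A \<inter> C l)) * z ^ l) / complex_of_real (prob A)"
    by (simp add: Q_eq sum_divide_distrib)
  then show ?thesis
    using * pos by simp
qed

end

section \<open>The fixed-point equation\<close>

lemma z_transform_eq_sum:
  assumes "Y \<in> measurable H (count_space UNIV)"
    and "distr H (count_space UNIV) Y = measure_pmf \<pi>" and "set_pmf \<pi> \<subseteq> {..N}"
  shows "z_transform H Y w = (\<Sum>k\<le>N. complex_of_real (pmf \<pi> k) * w ^ k)"
proof -
  have "z_transform H Y w = integral\<^sup>L (distr H (count_space UNIV) Y) (\<lambda>k. w ^ k)"
    unfolding z_transform_def by (rule integral_distr[symmetric]) (auto intro: assms)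
  also have "\<dots> = (\<Sum>k\<le>N. pmf \<pi> k *\<^sub>R w ^ k)"
    unfolding assms(2) by (rule integral_measure_pmf) (use assms(3) in auto)
  finally show ?thesis
    by (simp add: scaleR_conv_of_real)
qed

lemma sum_slot_gf_eq:
  fixes c :: "nat \<Rightarrow> complex"
  assumes "(1 - complex_of_real p) * z + complex_of_real p \<noteq> 0"
  shows "(\<Sum>k\<le>N. c k * slot_gf N k z (p, r))
       = ((1 - complex_of_real p) * z + complex_of_real p) ^ N *
         (\<Sum>k\<le>N. c k * ((complex_of_real r * z + 1 - complex_of_real r)
                      / ((1 - complex_of_real p) * z + complex_of_real p)) ^ k)"
  unfolding sum_distrib_left
  by (intro sum.cong refl)
     (use assms in \<open>simp add: slot_gf_def power_diff power_divide\<close>)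

theorem mainTheorem5:
  fixes M :: "'a measure" and N :: nat
    and P R :: "nat \<Rightarrow> 'a \<Rightarrow> real" and X :: "nat \<Rightarrow> nat \<Rightarrow> 'a \<Rightarrow> bool"
    and G :: "'b measure" and PG RG :: "'b \<Rightarrow> real"
    and H :: "'c measure" and Y :: "'c \<Rightarrow> nat" and \<pi> :: "nat pmf"
  assumes model: "er_resampling M N P R X"
  shows
    \<comment> \<open>for \<open>m \<ge> 2\<close> the conditioning event always has positive probability\<close>
    "(\<forall>m k z. 1 \<le> m \<longrightarrow> k \<le> N \<longrightarrow>
        (m = 1 \<longrightarrow> \<P>(\<omega> in M. num_present N X 0 \<omega> = k) > 0) \<longrightarrow>
        cond_gen_fun M (num_present N X) m k z =
          (\<integral>\<omega>. ((1 - complex_of_real (P m \<omega>)) * z + complex_of_real (P m \<omega>)) ^ (N - k)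
               * (complex_of_real (R m \<omega>) * z + 1 - complex_of_real (R m \<omega>)) ^ k \<partial>M))
     \<and>
     (PG \<in> borel_measurable G \<longrightarrow> RG \<in> borel_measurable G \<longrightarrow>
      distr G borel (\<lambda>\<omega>. (PG \<omega>, RG \<omega>)) = distr M borel (\<lambda>\<omega>. (P 1 \<omega>, R 1 \<omega>)) \<longrightarrow>
      Y \<in> measurable H (count_space UNIV) \<longrightarrow>
      distr H (count_space UNIV) Y = measure_pmf \<pi> \<longrightarrow>
      stationary_distribution M {..N} (num_present N X) \<pi> \<longrightarrow>
      (\<forall>z. (AE \<omega> in G. (1 - complex_of_real (PG \<omega>)) * z + complex_of_real (PG \<omega>) \<noteq> 0) \<longrightarrow>
         z_transform H Y z =
           (\<integral>\<omega>. ((1 - complex_of_real (PG \<omega>)) * z + complex_of_real (PG \<omega>)) ^ N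
                * z_transform H Y
                    ((complex_of_real (RG \<omega>) * z + 1 - complex_of_real (RG \<omega>))
                     / ((1 - complex_of_real (PG \<omega>)) * z + complex_of_real (PG \<omega>))) \<partial>G)))"
proof -
  interpret er_resampling M N P R X by (rule model)
  show ?thesis
  proof (intro conjI allI impI)
    fix m k :: nat and z :: complex
    assume m: "1 \<le> m" and k: "k \<le> N"
      and init: "m = 1 \<longrightarrow> \<P>(\<omega> in M. num_present N X 0 \<omega> = k) > 0"
    have "0 < prob {\<omega> \<in> space M. num_present N X (m - 1) \<omega> = k}"
      using init prob_num_present_pos[of "m - 1" k] m k by (cases "m = 1") auto
    from cond_gen_fun_eq[OF m k this, of z]
    show "cond_gen_fun M (num_present N X) m k z =
        (\<integral>\<omega>. ((1 - complex_of_real (P m \<omega>)) * z + complex_of_real (P m \<omega>)) ^ (N - k)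
               * (complex_of_real (R m \<omega>) * z + 1 - complex_of_real (R m \<omega>)) ^ k \<partial>M)"
      by (simp add: slot_gf_def)
  next
    fix z :: complex
    assume PG [measurable]: "PG \<in> borel_measurable G" and RG [measurable]: "RG \<in> borel_measurable G"
      and dist: "distr G borel (\<lambda>\<omega>. (PG \<omega>, RG \<omega>)) = distr M borel (\<lambda>\<omega>. (P 1 \<omega>, R 1 \<omega>))"
      and Y: "Y \<in> measurable H (count_space UNIV)"
      and \<pi>: "distr H (count_space UNIV) Y = measure_pmf \<pi>"
      and stat: "stationary_distribution M {..N} (num_present N X) \<pi>"
      and nz: "AE \<omega> in G. (1 - complex_of_real (PG \<omega>)) * z + complex_of_real (PG \<omega>) \<noteq> 0"
    from stat obtain Q where Q: "transition_matrix M {..N} (num_present N X) Q"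
      and supp: "set_pmf \<pi> \<subseteq> {..N}"
      and inv: "\<And>l. l \<le> N \<Longrightarrow> pmf \<pi> l = (\<Sum>k\<le>N. pmf \<pi> k * Q k l)"
      unfolding stationary_distribution_def by auto
    note zt = z_transform_eq_sum[OF Y \<pi> supp]
    have sampG: "(\<lambda>\<omega>. (PG \<omega>, RG \<omega>)) \<in> borel_measurable G"
      by measurable
    \<comment> \<open>Both the value and the integrability of the integrals depend on the sample only through its
      law, so they carry over from the model's slot 1 to the generic sample on \<open>G\<close>.\<close>
    have eqG: "(\<integral>\<omega>. slot_gf N k z (P 1 \<omega>, R 1 \<omega>) \<partial>M) = (\<integral>\<omega>. slot_gf N k z (PG \<omega>, RG \<omega>) \<partial>G)" for k
      using integral_distr[OF sampG slot_gf_measurable, of N k z]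
        integral_distr[OF sample_measurable[of 1] slot_gf_measurable, of N k z] by (simp add: dist)
    have intG: "integrable G (\<lambda>\<omega>. slot_gf N k z (PG \<omega>, RG \<omega>))" if "k \<le> N" for k
    proof -
      have "integrable (distr M borel (\<lambda>\<omega>. (P 1 \<omega>, R 1 \<omega>))) (slot_gf N k z)"
        using integrable_slot_gf[of 1 k z] that
        by (subst integrable_distr_eq) (auto intro: sample_measurable)
      then show ?thesis
        unfolding dist[symmetric] by (subst (asm) integrable_distr_eq) (use sampG in auto)
    qed
    have "z_transform H Y z
        = (\<Sum>l\<le>N. \<Sum>k\<le>N. complex_of_real (pmf \<pi> k) * (complex_of_real (Q k l) * z ^ l))"
      unfolding zt by (intro sum.cong refl) (simp add: inv sum_distrib_right mult.assoc)
    also have "\<dots> = (\<Sum>k\<le>N. complex_of_real (pmf \<pi> k) * (\<Sum>l\<le>N. complex_of_real (Q k l) * z ^ l))"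
      by (subst sum.swap) (simp add: sum_distrib_left)
    also have "\<dots> = (\<Sum>k\<le>N. complex_of_real (pmf \<pi> k) * (\<integral>\<omega>. slot_gf N k z (PG \<omega>, RG \<omega>) \<partial>G))"
      by (intro sum.cong refl) (simp only: sum_transition_matrix[OF Q] eqG atMost_iff)
    also have "\<dots> = (\<integral>\<omega>. (\<Sum>k\<le>N. complex_of_real (pmf \<pi> k) * slot_gf N k z (PG \<omega>, RG \<omega>)) \<partial>G)"
      using intG by (simp add: Bochner_Integration.integral_sum)
    also have "\<dots> = (\<integral>\<omega>. ((1 - complex_of_real (PG \<omega>)) * z + complex_of_real (PG \<omega>)) ^ N
                * z_transform H Y
                    ((complex_of_real (RG \<omega>) * z + 1 - complex_of_real (RG \<omega>))
                     / ((1 - complex_of_real (PG \<omega>)) * z + complex_of_real (PG \<omega>))) \<partial>G)"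
    proof (rule integral_cong_AE)
      show "(\<lambda>\<omega>. \<Sum>k\<le>N. complex_of_real (pmf \<pi> k) * slot_gf N k z (PG \<omega>, RG \<omega>)) \<in> borel_measurable G"
        using measurable_compose[OF sampG slot_gf_measurable] by measurable
    qed (unfold zt, measurable, use nz in eventually_elim, rule sum_slot_gf_eq)
    finally show "z_transform H Y z =
           (\<integral>\<omega>. ((1 - complex_of_real (PG \<omega>)) * z + complex_of_real (PG \<omega>)) ^ N
                * z_transform H Y
                    ((complex_of_real (RG \<omega>) * z + 1 - complex_of_real (RG \<omega>))
                     / ((1 - complex_of_real (PG \<omega>)) * z + complex_of_real (PG \<omega>))) \<partial>G)" .
  qed
qed

end
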